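(* Let $X$ be a real normed space and let $\mathcal F$ be a directionally fine family of closed cones in $X$. Let $K\subset X$ be a closed cone and let $x_0\in X\setminus K$. Then, for every $0<\varepsilon<d(x_0,K)$, there exist a cone $C\in\mathcal F$ and an adapted defining function $\varphi$ for $C$ such that \[ x_0\in\operatorname{int}C\subset C\subset\operatorname{cone}B(x_0,\varepsilon),\qquad K\cap C=\{0_X\}, \] and $\varphi(x_0)=\|x_0\|$. Moreover, for every $0<\rho<\|x_0\|$, the set $U_\rho:=\{x\in X:\varphi(x)>\rho\}$ is an open neighborhood of $x_0$ satisfying $U_\rho\subset\operatorname{int}C$ and \[ \varphi(k)\le 0<\rho<\varphi(x)\qquad\forall k\in K,\ \forall x\in U_\rho. \]
   Context: $S_X$ is the unit sphere, $B(x,r)=\{y\in X:\|y-x\|\le r\}$, $\operatorname{cone}(A)=\{ta:t\ge0,\ a\in A\}$, $d(x,A)=\inf_{a\in A}\|x-a\|$. A nonempty set $C\subset X$ is a cone if $tC\subset C$ for every $t\ge 0$; all cones are assumed proper, i.e. $\{0_X\}\subsetneq C\subsetneq X$ (not necessarily convex). A family $\mathcal F$ of closed cones in $X$ is directionally fine if for every $u\in S_X$ and $\varepsilon\in(0,1)$ there exists $C\in\mathcal F$ with $u\in\operatorname{int}C\subset C\subset\operatorname{cone}B(u,\varepsilon)$. A mapping is positively homogeneous if $\varphi(tx)=t\varphi(x)$ for all $t\ge0$, $x\in X$. For a closed cone $C$, an adapted defining function for $C$ (at a direction $u\in S_X\cap\operatorname{int}C$) is a continuous positively homogeneous $\varphi:X\to\mathbb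 R$ with $C=\{\varphi\ge0\}$, $\varphi(u)=1$, and $\varphi(x)\le\|x\|$ for every $x\in X$; here the direction is $u=x_0/\|x_0\|$. *)

theory Defs
  imports "HOL-Analysis.Analysis"
begin

(* The library predicate cone also admits the empty set, the zero cone and the whole space;
   these are excluded here. No convexity is required. *)
definition proper_cone :: "'a::real_vector set \<Rightarrow> bool" where
  "proper_cone C \<longleftrightarrow> C \<noteq> {} \<and> cone C \<and> {0} \<subset> C \<and> C \<subset> UNIV"

definition closed_cone :: "'a::real_normed_vector set \<Rightarrow> bool" where
  "closed_cone C \<longleftrightarrow> proper_cone C \<and> closed C"

definition cone_of :: "'a::real_vector set \<Rightarrow> 'a set" where
  "cone_of A = {t *\<^sub>R a | t a. 0 \<le> t \<and> a \<in> A}"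

lemma cone_of_eq_cone_hull: "cone_of A = cone hull A"
  by (simp add: cone_of_def cone_hull_expl)

definition directionally_fine :: "'a::real_normed_vector set set \<Rightarrow> bool" where
  "directionally_fine F \<longleftrightarrow>
     (\<forall>C\<in>F. closed_cone C) \<and>
     (\<forall>u\<in>sphere 0 1. \<forall>\<epsilon>\<in>{0<..<1}. \<exists>C\<in>F.
        u \<in> interior C \<and> interior C \<subseteq> C \<and> C \<subseteq> cone_of (cball u \<epsilon>))"

definition positively_homogeneous :: "('a::real_vector \<Rightarrow> 'b::real_vector) \<Rightarrow> bool" where
  "positively_homogeneous \<phi> \<longleftrightarrow> (\<forall>t\<ge>0. \<forall>x. \<phi> (t *\<^sub>R x) = t *\<^sub>R \<phi> x)"

definition adapted_defining_function ::
    "'a::real_normed_vector set \<Rightarrow> 'a \<Rightarrow> ('a \<Rightarrow> real) \<Rightarrow> bool" where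
  "adapted_defining_function C u \<phi> \<longleftrightarrow>
     closed_cone C \<and> u \<in> sphere 0 1 \<inter> interior C \<and>
     continuous_on UNIV \<phi> \<and> positively_homogeneous \<phi> \<and>
     C = {x. 0 \<le> \<phi> x} \<and> \<phi> u = 1 \<and> (\<forall>x. \<phi> x \<le> norm x)"

end

theory Submission
  imports Defs
begin

text \<open>
  For a closed cone \<open>C\<close> the signed distance \<open>d(x, X - C) - d(x, C)\<close> is continuous,
  positively homogeneous and nonnegative exactly on \<open>C\<close>. Dividing it by its value at a unit
  vector \<open>u\<close> of the interior and truncating by the norm gives an adapted defining function.
  Directional fineness at \<open>x0 / norm x0\<close> with radius \<open>\<epsilon> / norm x0\<close>, which is less than 1
  because \<open>0 \<in> K\<close>, gives \<open>C\<close>; it meets \<open>K\<close> only at 0 because \<open>K\<close> misses the ball of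
  radius \<open>\<epsilon>\<close> around \<open>x0\<close> and is invariant under scaling.
\<close>

text \<open>Scaling by \<open>t\<close> sends each competitor \<open>a\<close> for \<open>x\<close>
  to a competitor for \<open>t *\<^sub>R x\<close> at \<open>t\<close> times the distance.
  Invariance is asked only for positive factors, so that the complement of a cone, which misses 0,
  also qualifies.\<close>

lemma infdist_scaleR_le:
  fixes A :: "'a::real_normed_vector set"
  assumes "A \<noteq> {}" and A: "\<And>s a. 0 < s \<Longrightarrow> a \<in> A \<Longrightarrow> s *\<^sub>R a \<in> A" and "0 < t"
  shows "infdist (t *\<^sub>R x) A \<le> t * infdist x A"
proof -
  have "infdist (t *\<^sub>R x) A / t \<le> (INF a\<in>A. dist x a)"
  proof (rule cINF_greatest[OF assms(1)])
    fix a assume "a \<in> A"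
    then have "infdist (t *\<^sub>R x) A \<le> dist (t *\<^sub>R x) (t *\<^sub>R a)"
      using A \<open>0 < t\<close> by (intro infdist_le) auto
    also have "\<dots> = t * dist x a"
      using \<open>0 < t\<close> by (simp add: dist_norm flip: scaleR_diff_right)
    finally show "infdist (t *\<^sub>R x) A / t \<le> dist x a"
      using \<open>0 < t\<close> by (simp add: field_simps)
  qed
  then have "infdist (t *\<^sub>R x) A / t \<le> infdist x A"
    by (simp only: infdist_notempty[OF assms(1), of x])
  then show ?thesis
    using \<open>0 < t\<close> by (simp add: field_simps)
qed

lemma infdist_scaleR:
  fixes A :: "'a::real_normed_vector set"
  assumes "A \<noteq> {}" and A: "\<And>s a. 0 < s \<Longrightarrow> a \<in> A \<Longrightarrow> s *\<^sub>R a \<in> A" and "0 < t"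
  shows "infdist (t *\<^sub>R x) A = t * infdist x A"
proof (rule antisym)
  show "infdist (t *\<^sub>R x) A \<le> t * infdist x A"
    using assms by (rule infdist_scaleR_le)
  \<comment> \<open>The reverse inequality is the first one with factor \<open>inverse t\<close> at
    the point \<open>t *\<^sub>R x\<close>.\<close>
  have "infdist (inverse t *\<^sub>R (t *\<^sub>R x)) A \<le> inverse t * infdist (t *\<^sub>R x) A"
    using assms by (intro infdist_scaleR_le) auto
  then show "t * infdist x A \<le> infdist (t *\<^sub>R x) A"
    using \<open>0 < t\<close> by (simp add: field_simps)
qed

lemma adapted_defining_function_exists:
  fixes C :: "'a::real_normed_vector set" and u :: 'a
  assumes C: "closed_cone C" and u: "norm u = 1" "u \<in> interior C"
  shows "\<exists>\<phi>. adapted_defining_function C u \<phi>"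
proof -
  define g where "g x = infdist x (- C) - infdist x C" for x
  define \<phi> where "\<phi> x = min (g x / g u) (norm x)" for x
  have clo: "closed C" and cone: "\<And>s a. 0 \<le> s \<Longrightarrow> a \<in> C \<Longrightarrow> s *\<^sub>R a \<in> C"
    and ne: "C \<noteq> {}" "- C \<noteq> {}"
    using C by (auto simp: closed_cone_def proper_cone_def cone_def)
  have cocone: "s *\<^sub>R a \<in> - C" if "0 < s" "a \<in> - C" for s a
    using cone[of "inverse s" "s *\<^sub>R a"] that by auto
  have g_pos: "0 \<le> g x \<longleftrightarrow> x \<in> C" for x
  proof (cases "x \<in> C")
    case True
    then show ?thesis by (simp add: g_def infdist_nonneg)
  next
    case False
    then have "0 < infdist x C"
      using clo ne by (simp add: infdist_pos_not_in_closed)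
    with False show ?thesis by (simp add: g_def)
  qed
  have "u \<notin> closure (- C)"
    using u(2) by (simp add: closure_complement)
  \<comment> \<open>\<open>infdist\<close> to the empty set is 0 by convention, so properness of
    \<open>C\<close> matters here: it makes \<open>- C\<close> nonempty.\<close>
  then have "infdist u (- C) \<noteq> 0"
    using ne(2) by (simp add: in_closure_iff_infdist_zero)
  moreover have "u \<in> C"
    using u(2) interior_subset by blast
  ultimately have gu: "0 < g u"
    by (simp add: g_def infdist_nonneg order.not_eq_order_implies_strict)
  have g_scale: "g (t *\<^sub>R x) = t * g x" if "0 < t" for t x
    using infdist_scaleR[OF ne(1) _ that, of x] infdist_scaleR[OF ne(2) _ that, of x] cone cocone
    by (simp add: g_def algebra_simps)
  \<comment> \<open>\<open>g_scale\<close> covers positive factors only; since doubling fixes 0, it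
    still determines \<open>g 0\<close>, which settles homogeneity at \<open>t = 0\<close>.\<close>
  have "2 * g 0 = g 0"
    using g_scale[of 2 0] by simp
  then have g0: "g 0 = 0" by simp
  have "continuous_on UNIV \<phi>"
    unfolding \<phi>_def g_def by (intro continuous_intros) (use gu in \<open>auto simp: g_def\<close>)
  moreover have "positively_homogeneous \<phi>"
    unfolding positively_homogeneous_def
  proof (intro allI impI)
    fix t :: real and x assume "0 \<le> t"
    then consider "t = 0" | "0 < t" by fastforce
    then show "\<phi> (t *\<^sub>R x) = t *\<^sub>R \<phi> x"
      by cases (simp_all add: \<phi>_def g0 g_scale min_mult_distrib_left)
  qed
  \<comment> \<open>Truncation by the nonnegative \<open>norm x\<close> leaves the set of
    nonnegativity unchanged.\<close>
  moreover have "0 \<le> \<phi> x \<longleftrightarrow> 0 \<le> g x" for x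
    using gu by (auto simp: \<phi>_def zero_le_divide_iff)
  then have "C = {x. 0 \<le> \<phi> x}"
    by (simp add: g_pos)
  moreover have "\<phi> u = 1" "\<forall>x. \<phi> x \<le> norm x"
    using gu u(1) by (simp_all add: \<phi>_def)
  moreover have "u \<in> sphere 0 1 \<inter> interior C"
    using u by simp
  ultimately have "adapted_defining_function C u \<phi>"
    using C unfolding adapted_defining_function_def by blast
  then show ?thesis by (rule exI[of _ \<phi>])
qed

text \<open>A ray through \<open>a\<close> also passes through \<open>r *\<^sub>R a\<close>, so
  dilating the ball does not lose any ray. This carries the inclusion from the unit vector back to
  \<open>x0\<close>.\<close>

lemma cone_of_cball_subset_scaleR:
  fixes u :: "'a::real_normed_vector"
  assumes "0 < r"
  shows "cone_of (cball u e) \<subseteq> cone_of (cball (r *\<^sub>R u) (r * e))"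
proof
  fix y assume "y \<in> cone_of (cball u e)"
  then obtain t a where ta: "y = t *\<^sub>R a" "0 \<le> t" "dist u a \<le> e"
    by (auto simp: cone_of_def)
  have "dist (r *\<^sub>R u) (r *\<^sub>R a) = r * dist u a"
    using assms by (simp add: dist_norm flip: scaleR_diff_right)
  then have "r *\<^sub>R a \<in> cball (r *\<^sub>R u) (r * e)"
    using assms ta by simp
  moreover have "y = (t / r) *\<^sub>R (r *\<^sub>R a)" "0 \<le> t / r"
    using assms ta by simp_all
  ultimately show "y \<in> cone_of (cball (r *\<^sub>R u) (r * e))"
    unfolding cone_of_def by blast
qed

text \<open>A nonzero common point is a positive multiple of some \<open>a\<close> in the ball;
  scaling back puts \<open>a\<close> in \<open>K\<close>, closer to \<open>x\<close> than
  \<open>infdist x K\<close> allows.\<close>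

lemma cone_Int_cone_of_cball_subset:
  fixes K :: "'a::real_normed_vector set"
  assumes "cone K" and "e < infdist x K"
  shows "K \<inter> cone_of (cball x e) \<subseteq> {0}"
proof (rule subsetI, rule ccontr)
  fix y assume y: "y \<in> K \<inter> cone_of (cball x e)" "y \<notin> {0}"
  then obtain t a where ta: "y = t *\<^sub>R a" "0 \<le> t" "dist x a \<le> e"
    by (auto simp: cone_of_def)
  with y have "0 < t" by (cases "t = 0") auto
  then have "a = inverse t *\<^sub>R y" using ta by simp
  then have "a \<in> K"
    using \<open>cone K\<close> y \<open>0 < t\<close> by (simp add: cone_def)
  then have "infdist x K \<le> dist x a" by (rule infdist_le)
  with ta assms show False by simp
qed

theorem proposition3p1:
  fixes F :: "'a::real_normed_vector set set" and K :: "'a set" and x0 :: 'a and \<epsilon> :: real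
  assumes "directionally_fine F"
    and "closed_cone K"
    and "x0 \<notin> K"
    and "0 < \<epsilon>" and "\<epsilon> < infdist x0 K"
  shows "\<exists>C\<in>F. \<exists>\<phi>. adapted_defining_function C (x0 /\<^sub>R norm x0) \<phi> \<and>
           x0 \<in> interior C \<and> interior C \<subseteq> C \<and> C \<subseteq> cone_of (cball x0 \<epsilon>) \<and>
           K \<inter> C = {0} \<and>
           \<phi> x0 = norm x0 \<and>
           (\<forall>\<rho>. 0 < \<rho> \<and> \<rho> < norm x0 \<longrightarrow>
              (let U = {x. \<phi> x > \<rho>} in
                 open U \<and> x0 \<in> U \<and> U \<subseteq> interior C \<and>
                 (\<forall>k\<in>K. \<forall>x\<in>U. \<phi> k \<le> 0 \<and> 0 < \<rho> \<and> \<rho> < \<phi> x)))"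
proof -
  define n where "n = norm x0"
  define u where "u = x0 /\<^sub>R n"
  have K: "cone K" "0 \<in> K"
    using assms(2) by (auto simp: closed_cone_def proper_cone_def)
  have "\<epsilon> < n"
    using assms(5) infdist_le[OF K(2), of x0] by (simp add: n_def)
  with assms(4) have n: "0 < n" and e: "\<epsilon> / n \<in> {0<..<1}" by auto
  have u: "norm u = 1" "n *\<^sub>R u = x0"
    using n by (auto simp: u_def n_def)
  then have "u \<in> sphere 0 1" by simp
  with assms(1) e obtain C where C: "C \<in> F" "u \<in> interior C" "C \<subseteq> cone_of (cball u (\<epsilon> / n))"
    unfolding directionally_fine_def by blast
  have "closed_cone C"
    using assms(1) C(1) by (simp add: directionally_fine_def)
  then obtain \<phi> where \<phi>: "adapted_defining_function C u \<phi>"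
    using adapted_defining_function_exists u(1) C(2) by blast
  then have cont: "continuous_on UNIV \<phi>" and Ceq: "C = {x. 0 \<le> \<phi> x}" and "\<phi> u = 1"
    and hom: "\<And>t x. 0 \<le> t \<Longrightarrow> \<phi> (t *\<^sub>R x) = t * \<phi> x"
    by (auto simp: adapted_defining_function_def positively_homogeneous_def)
  then have \<phi>x0: "\<phi> x0 = n"
    using hom[of n u] u n by simp
  have sub: "C \<subseteq> cone_of (cball x0 \<epsilon>)"
    using C(3) cone_of_cball_subset_scaleR[OF n, of u "\<epsilon> / n"] u n by simp
  have \<phi>0: "\<phi> 0 = 0"
    using hom[of 0 0] by simp
  have KC: "K \<inter> C = {0}"
    using cone_Int_cone_of_cball_subset[OF K(1) assms(5)] sub K(2) \<phi>0 Ceq by auto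
  have op: "open {x. \<rho> < \<phi> x}" for \<rho>
    using cont by (intro open_Collect_less) auto
  \<comment> \<open>The case \<open>\<rho> = 0\<close> places \<open>x0\<close> in the interior of
    \<open>C\<close>; positive \<open>\<rho>\<close> serves the sets \<open>U\<close>.\<close>
  have int: "{x. \<rho> < \<phi> x} \<subseteq> interior C" if "0 \<le> \<rho>" for \<rho>
    using op[of \<rho>] that by (intro interior_maximal) (auto simp: Ceq)
  \<comment> \<open>Away from 0, \<open>K\<close> lies outside \<open>C\<close>, where
    \<open>\<phi>\<close> is negative; at 0 homogeneity gives the value 0.\<close>
  have Kneg: "\<phi> k \<le> 0" if "k \<in> K" for k
  proof (cases "k = 0")
    case False
    then have "k \<notin> C" using KC that by blast
    then have "\<not> 0 \<le> \<phi> k" by (subst (asm) Ceq) simp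
    then show ?thesis by simp
  qed (simp add: \<phi>0)
  show ?thesis
  proof (intro bexI[of _ C] exI[of _ \<phi>] conjI allI impI)
    show "adapted_defining_function C (x0 /\<^sub>R norm x0) \<phi>"
      using \<phi> by (simp add: u_def n_def)
    show "x0 \<in> interior C"
      using int[of 0] \<phi>x0 n by auto
    fix \<rho> :: real assume \<rho>: "0 < \<rho> \<and> \<rho> < norm x0"
    show "let U = {x. \<rho> < \<phi> x} in open U \<and> x0 \<in> U \<and> U \<subseteq> interior C \<and>
        (\<forall>k\<in>K. \<forall>x\<in>U. \<phi> k \<le> 0 \<and> 0 < \<rho> \<and> \<rho> < \<phi> x)"
      unfolding Let_def using \<rho> op[of \<rho>] int[of \<rho>] \<phi>x0 Kneg by (simp add: n_def)
  qed (use C(1) sub KC \<phi>x0 interior_subset in \<open>simp_all add: n_def\<close>)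
qed

end
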